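(* Let $\gamma \geq 2$ and $n \geq 3\gamma$ be integers. Let $\mathcal{B}_{n,\gamma}$ denote the set of all bipartite graphs without isolated vertices that have order $n$, domination number $\gamma$, and exactly one minimum dominating set. Then there exists $G \in \mathcal{B}_{n,\gamma}$ whose number of edges $s(G)$ equals $$m(n,\gamma) = 2 \gamma + 2 \Big\lceil \frac{\gamma}{2} \Big\rceil \Big\lfloor \frac{\gamma}{2} \Big\rfloor + \min\Big\{n-3\gamma,\ 2 \Big\lceil \frac{\gamma}{2} \Big\rceil - \Big\lfloor \frac{\gamma}{2}\Big\rfloor+ 1\Big\}\Big(2\Big\lceil\frac{\gamma}{2}\Big\rceil + 1\Big) + \sum_{i=1}^{\Phi} \Big(\Big(2\Big\lceil\frac{\gamma}{2}\Big\rceil+1\Big) + \Big\lceil\frac{i}{2}\Big\rceil\Big),$$ where $\Phi = \Phi(n,\gamma) = \max\big(0,\ n-3\gamma - 2\lceil\frac{\gamma}{2}\rceil - \lfloor\frac{\gamma}{2}\rfloor + 1\big)$ (an empty sum is $0$).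
   Context: All graphs are finite and simple. A dominating set of a graph $G=(V,E)$ is a set $D\subseteq V$ such that every vertex of $V\setminus D$ is adjacent to some vertex of $D$; the domination number $\gamma(G)$ is the minimum size of a dominating set, and a minimum dominating set is a dominating set of size $\gamma(G)$. The size $s(G)$ is the number of edges of $G$. *)

theory Defs
  imports Complex_Main
begin

text \<open>A graph is a pair of its vertex set and its edge set; an edge is a two-element set of vertices.\<close>

type_synonym 'a graph = "'a set \<times> 'a set set"

definition verts :: "'a graph \<Rightarrow> 'a set" where
  "verts G = fst G"

definition edges :: "'a graph \<Rightarrow> 'a set set" where
  "edges G = snd G"

definition finite_simple_graph :: "'a graph \<Rightarrow> bool" where
  "finite_simple_graph G \<longleftrightarrow>
     finite (verts G) \<and> (\<forall>e\<in>edges G. e \<subseteq> verts G \<and> card e = 2)"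

definition adjacent :: "'a graph \<Rightarrow> 'a \<Rightarrow> 'a \<Rightarrow> bool" where
  "adjacent G u v \<longleftrightarrow> {u, v} \<in> edges G"

definition graph_order :: "'a graph \<Rightarrow> nat" where
  "graph_order G = card (verts G)"

definition graph_size :: "'a graph \<Rightarrow> nat" where
  "graph_size G = card (edges G)"

definition bipartite :: "'a graph \<Rightarrow> bool" where
  "bipartite G \<longleftrightarrow>
     (\<exists>X Y. X \<union> Y = verts G \<and> X \<inter> Y = {} \<and>
        (\<forall>e\<in>edges G. \<exists>x\<in>X. \<exists>y\<in>Y. e = {x, y}))"

definition no_isolated_vertices :: "'a graph \<Rightarrow> bool" where
  "no_isolated_vertices G \<longleftrightarrow> (\<forall>v\<in>verts G. \<exists>u\<in>verts G. adjacent G u v)"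

definition dominating_set :: "'a graph \<Rightarrow> 'a set \<Rightarrow> bool" where
  "dominating_set G D \<longleftrightarrow>
     D \<subseteq> verts G \<and> (\<forall>v\<in>verts G - D. \<exists>u\<in>D. adjacent G u v)"

definition domination_number :: "'a graph \<Rightarrow> nat" where
  "domination_number G = (LEAST k. \<exists>D. dominating_set G D \<and> card D = k)"

definition minimum_dominating_set :: "'a graph \<Rightarrow> 'a set \<Rightarrow> bool" where
  "minimum_dominating_set G D \<longleftrightarrow>
     dominating_set G D \<and> card D = domination_number G"

text \<open>Every finite graph is isomorphic to one whose vertices are natural numbers.\<close>

definition B_graphs :: "nat \<Rightarrow> nat \<Rightarrow> nat graph set" where
  "B_graphs n \<gamma> = {G. finite_simple_graph G \<and> bipartite G \<and> no_isolated_vertices G \<and>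
     graph_order G = n \<and> domination_number G = \<gamma> \<and> (\<exists>!D. minimum_dominating_set G D)}"

text \<open>The formulas are evaluated over the integers, since the subtractions may be negative.\<close>

definition Phi :: "nat \<Rightarrow> nat \<Rightarrow> int" where
  "Phi n \<gamma> = max 0 (int n - 3 * int \<gamma> - 2 * \<lceil>real \<gamma> / 2\<rceil> - \<lfloor>real \<gamma> / 2\<rfloor> + 1)"

definition m_edges :: "nat \<Rightarrow> nat \<Rightarrow> int" where
  "m_edges n \<gamma> =
     2 * int \<gamma> + 2 * \<lceil>real \<gamma> / 2\<rceil> * \<lfloor>real \<gamma> / 2\<rfloor>
     + min (int n - 3 * int \<gamma>) (2 * \<lceil>real \<gamma> / 2\<rceil> - \<lfloor>real \<gamma> / 2\<rfloor> + 1)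
         * (2 * \<lceil>real \<gamma> / 2\<rceil> + 1)
     + (\<Sum>i = 1..Phi n \<gamma>. (2 * \<lceil>real \<gamma> / 2\<rceil> + 1) + \<lceil>real_of_int i / 2\<rceil>)"

end

theory Submission
  imports Defs
begin

text \<open>
  Let \<open>D = C \<union> F\<close> with \<open>|C| = \<lceil>\<gamma>/2\<rceil>\<close> and \<open>|F| = \<lfloor>\<gamma>/2\<rfloor>\<close>. Every other vertex is attached to
  exactly one vertex of \<open>D\<close>, its parent: the vertices of \<open>U\<close> to a vertex of \<open>F\<close>, those of \<open>W\<close> to a
  vertex of \<open>C\<close>. Every \<open>d \<in> F\<close> has a child that is a leaf of the graph and a further child, and every
  \<open>d \<in> C\<close> has two children. Between the non-leaves of \<open>U\<close> and \<open>W\<close> an arbitrary bipartite graph \<open>R\<close> is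
  allowed. The stars around the vertices of \<open>D\<close> are their closed neighbourhoods and partition the
  vertices, so a dominating set has at least \<open>\<gamma>\<close> elements, and one with exactly \<open>\<gamma>\<close> elements meets each
  star once. In the stars around \<open>F\<close> it can only pick the centre or the leaf, so it cannot dominate
  both children of a vertex of \<open>C\<close> unless it contains \<open>C\<close>; then it avoids \<open>W\<close>, and the non-leaf
  children of \<open>F\<close> force it to contain \<open>F\<close>. Hence the number of edges can be any value between
  \<open>|U| + |W|\<close> and \<open>|U| + |W| + (|U| - |F|) |W|\<close>, and the sizes of \<open>U\<close> and \<open>W\<close> can be chosen such that
  \<open>m(n,\<gamma>)\<close> lies in this range.
\<close>

section \<open>Stars around the centres, joined by a bipartite graph\<close>

locale parent_graph =
  fixes C F L U W :: "'a set" and h :: "'a \<Rightarrow> 'a" and R :: "('a \<times> 'a) set"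
  assumes finite_parts: "finite C" "finite F" "finite U" "finite W"
    and disjoint_parts: "C \<inter> F = {}" "(C \<union> F) \<inter> (U \<union> W) = {}" "U \<inter> W = {}"
    and parent_U: "x \<in> U \<Longrightarrow> h x \<in> F"
    and parent_W: "y \<in> W \<Longrightarrow> h y \<in> C"
    and leaves: "L \<subseteq> U"
    and R_subset: "R \<subseteq> (U - L) \<times> W"
    and leaf_child: "d \<in> F \<Longrightarrow> \<exists>l\<in>L. h l = d"
    and other_child: "d \<in> F \<Longrightarrow> \<exists>x\<in>U - L. h x = d"
    and two_children: "d \<in> C \<Longrightarrow> \<exists>y\<in>W. \<exists>z\<in>W. y \<noteq> z \<and> h y = d \<and> h z = d"
begin

lemma parent:
  assumes "x \<in> U \<union> W"
  shows "h x \<in> C \<union> F" "h x \<notin> U \<union> W"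
proof -
  show "h x \<in> C \<union> F" using assms parent_U[of x] parent_W[of x] by blast
  then show "h x \<notin> U \<union> W" using disjoint_parts(2) by blast
qed

definition G :: "'a graph" where
  "G = (C \<union> F \<union> U \<union> W, (\<lambda>x. {x, h x}) ` (U \<union> W) \<union> (\<lambda>(x, y). {x, y}) ` R)"

lemma verts_G: "verts G = C \<union> F \<union> U \<union> W"
  by (simp add: verts_def G_def)

lemma edges_G: "edges G = (\<lambda>x. {x, h x}) ` (U \<union> W) \<union> (\<lambda>(x, y). {x, y}) ` R"
  by (simp add: edges_def G_def)

lemma adjacent_G:
  "adjacent G u v \<longleftrightarrow> (u \<in> U \<union> W \<and> v = h u) \<or> (v \<in> U \<union> W \<and> u = h v) \<or> (u, v) \<in> R \<or> (v, u) \<in> R"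
  by (auto simp: adjacent_def edges_G doubleton_eq_iff image_iff)

lemma finite_simple_graph_G: "finite_simple_graph G"
proof -
  have "e \<subseteq> verts G \<and> card e = 2" if e: "e \<in> edges G" for e
  proof -
    consider x where "x \<in> U \<union> W" "e = {x, h x}" | x y where "(x, y) \<in> R" "e = {x, y}"
      using e by (auto simp: edges_G)
    then show ?thesis
    proof cases
      case 1
      then have "x \<noteq> h x" using parent(2)[of x] by metis
      then show ?thesis using 1 parent(1)[of x] by (auto simp: verts_G)
    next
      case 2
      then have "x \<in> U" "y \<in> W" using R_subset by auto
      moreover from this have "x \<noteq> y" using disjoint_parts by blast
      ultimately show ?thesis using 2 by (auto simp: verts_G)
    qed
  qed
  then show ?thesis
    using finite_parts by (simp add: finite_simple_graph_def verts_G)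
qed

text \<open>Colouring \<open>C\<close> like \<open>U\<close> and \<open>F\<close> like
  \<open>W\<close> works because parents of \<open>U\<close> lie in \<open>F\<close>, parents of
  \<open>W\<close> in \<open>C\<close>, and \<open>R\<close> runs from \<open>U\<close> to
  \<open>W\<close>.\<close>

lemma bipartite_G: "bipartite G"
  unfolding bipartite_def
proof (intro exI conjI ballI)
  show "(C \<union> U) \<union> (F \<union> W) = verts G" by (auto simp: verts_G)
  show "(C \<union> U) \<inter> (F \<union> W) = {}" using disjoint_parts by blast
  fix e assume "e \<in> edges G"
  then consider x where "x \<in> U" "e = {x, h x}" | x where "x \<in> W" "e = {h x, x}"
    | x y where "(x, y) \<in> R" "e = {x, y}"
    by (auto simp: edges_G)
  then show "\<exists>x\<in>C \<union> U. \<exists>y\<in>F \<union> W. e = {x, y}"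
  proof cases
    case 1 then show ?thesis using parent_U[of x] by blast
  next
    case 2 then show ?thesis using parent_W[of x] by blast
  next
    case 3 then show ?thesis using R_subset by blast
  qed
qed

lemma no_isolated_vertices_G: "no_isolated_vertices G"
proof -
  have "\<exists>u\<in>verts G. adjacent G u v" if "v \<in> verts G" for v
  proof -
    consider "v \<in> C" | "v \<in> F" | "v \<in> U" | "v \<in> W" using \<open>v \<in> verts G\<close> by (auto simp: verts_G)
    then show ?thesis
    proof cases
      case 1 then show ?thesis using two_children[of v] by (auto simp: verts_G adjacent_G)
    next
      case 2 then show ?thesis using other_child[of v] by (auto simp: verts_G adjacent_G)
    next
      case 3 then show ?thesis using parent_U[of v] by (auto simp: verts_G adjacent_G)
    next
      case 4 then show ?thesis using parent_W[of v] by (auto simp: verts_G adjacent_G)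
    qed
  qed
  then show ?thesis by (simp add: no_isolated_vertices_def)
qed

lemma graph_order_G: "graph_order G = card C + card F + card U + card W"
proof -
  have "(C \<union> F \<union> U) \<inter> W = {}" "(C \<union> F) \<inter> U = {}" using disjoint_parts by auto
  then show ?thesis
    using finite_parts disjoint_parts by (simp add: graph_order_def verts_G card_Un_disjoint)
qed

lemma graph_size_G: "graph_size G = card U + card W + card R"
proof -
  let ?p = "\<lambda>x. {x, h x}" and ?q = "\<lambda>(x, y). {x, y}"
  have "inj_on ?p (U \<union> W)"
  proof (rule inj_onI)
    fix x y assume "x \<in> U \<union> W" "y \<in> U \<union> W" and eq: "{x, h x} = {y, h y}"
    then have "x \<noteq> h y" using parent(2)[of y] by metis
    then show "x = y" using eq by (auto simp: doubleton_eq_iff)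
  qed
  then have 1: "card (?p ` (U \<union> W)) = card U + card W"
    using finite_parts disjoint_parts by (simp add: card_image card_Un_disjoint)
  have "inj_on ?q R"
  proof (rule inj_onI, clarify)
    fix x y x' y' assume "(x, y) \<in> R" "(x', y') \<in> R" and eq: "{x, y} = {x', y'}"
    then have "x \<in> U" "y' \<in> W" using R_subset by auto
    then have "x \<noteq> y'" using disjoint_parts(3) by blast
    then show "x = x' \<and> y = y'" using eq by (auto simp: doubleton_eq_iff)
  qed
  then have 2: "card (?q ` R) = card R"
    by (rule card_image)
  have "finite R"
    using finite_parts by (intro finite_subset[OF R_subset]) auto
  moreover have "?p ` (U \<union> W) \<inter> ?q ` R = {}"
  proof -
    \<comment> \<open>A parent edge has an end outside \<open>U \<union> W\<close>, an edge from
      \<open>R\<close> has none.\<close>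
    have "{x, h x} \<noteq> {a, b}" if "x \<in> U \<union> W" "(a, b) \<in> R" for x a b
      using parent[OF that(1)] that(2) R_subset by (auto simp: doubleton_eq_iff)
    then show ?thesis by auto
  qed
  ultimately show ?thesis
    using 1 2 finite_parts by (simp add: graph_size_def edges_G card_Un_disjoint)
qed

section \<open>Domination number and uniqueness\<close>

lemma dominating_set_centres: "dominating_set G (C \<union> F)"
  using parent_U parent_W by (auto simp: dominating_set_def verts_G adjacent_G)

definition centre :: "'a \<Rightarrow> 'a" where
  "centre v = (if v \<in> C \<union> F then v else h v)"

text \<open>Edges of \<open>R\<close> avoid the centres, so the vertices sent to \<open>d\<close> by
  \<open>centre\<close> form the closed neighbourhood of \<open>d\<close>, which every dominating
  set meets.\<close>

lemma centre_surj:
  assumes "dominating_set G S"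
  shows "C \<union> F \<subseteq> centre ` S"
proof
  fix d assume d: "d \<in> C \<union> F"
  show "d \<in> centre ` S"
  proof (cases "d \<in> S")
    case True
    then show ?thesis using d by (force simp: centre_def)
  next
    case False
    then obtain u where "u \<in> S" "adjacent G u d"
      using assms d by (auto simp: dominating_set_def verts_G)
    moreover from this have "u \<in> U \<union> W" "d = h u"
      using d disjoint_parts R_subset by (auto simp: adjacent_G)
    moreover from this have "u \<notin> C \<union> F" using disjoint_parts by blast
    ultimately show ?thesis by (auto simp: centre_def)
  qed
qed

lemma finite_dominating_set: "dominating_set G S \<Longrightarrow> finite S"
  using finite_parts by (auto simp: dominating_set_def verts_G intro: finite_subset)

lemma card_dominating_set:
  assumes "dominating_set G S"
  shows "card (C \<union> F) \<le> card S"
  using centre_surj[OF assms] finite_dominating_set[OF assms] by (rule surj_card_le[rotated])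

lemma dominating_set_unique:
  assumes S: "dominating_set G S" and card: "card S = card (C \<union> F)"
  shows "S = C \<union> F"
proof -
  have fin: "finite S" using S by (rule finite_dominating_set)
  have "card (C \<union> F) \<le> card (centre ` S)"
    using centre_surj[OF S] fin by (intro card_mono) auto
  \<comment> \<open>Equality of the cardinalities leaves \<open>S\<close> exactly one vertex in each
    star.\<close>
  then have inj: "inj_on centre S"
    using card card_image_le[OF fin, of centre] by (intro eq_card_imp_inj_on fin) linarith
  have sibling: "v = w" if "v \<in> S" "w \<in> S" "v \<in> U \<union> W" "w \<in> U \<union> W" "h v = h w" for v w
  proof -
    have "v \<notin> C \<union> F" "w \<notin> C \<union> F" using that disjoint_parts by blast+
    then show ?thesis using inj that by (auto simp: inj_on_def centre_def)
  qed
  have dominated: "v \<in> S \<or> h v \<in> S \<or> (\<exists>u\<in>S. (u, v) \<in> R \<or> (v, u) \<in> R)" if v: "v \<in> U \<union> W" for v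
  proof (cases "v \<in> S")
    case False
    then obtain u where "u \<in> S" "adjacent G u v"
      using S v by (auto simp: dominating_set_def verts_G)
    moreover have "\<not> (u \<in> U \<union> W \<and> v = h u)"
      using v parent(2)[of u] by metis
    ultimately show ?thesis by (auto simp: adjacent_G)
  qed simp
  \<comment> \<open>As \<open>x\<close> is the only vertex of \<open>S\<close> in its star,
    \<open>h x\<close> is not in \<open>S\<close>; the leaf \<open>l\<close> at \<open>h x\<close>
    must then dominate itself, so \<open>l = x\<close>.\<close>
  have U_S: "x \<in> L" if x: "x \<in> U" "x \<in> S" for x
  proof -
    obtain l where l: "l \<in> L" "h l = h x" using leaf_child[OF parent_U[OF x(1)]] by blast
    have "h x \<notin> S"
    proof
      assume "h x \<in> S"
      moreover have "h x \<in> C \<union> F" "x \<notin> C \<union> F" using x parent(1)[of x] disjoint_parts(2) by blast+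
      ultimately have "h x = x" using inj x by (auto simp: inj_on_def centre_def)
      then show False using \<open>h x \<in> C \<union> F\<close> \<open>x \<notin> C \<union> F\<close> by simp
    qed
    moreover have "\<not> ((u, l) \<in> R \<or> (l, u) \<in> R)" for u
      using l R_subset leaves disjoint_parts(3) by blast
    ultimately have "l \<in> S" using dominated[of l] l leaves by auto
    then show ?thesis using sibling[of l x] x l leaves by blast
  qed
  \<comment> \<open>\<open>R\<close> reaches children of \<open>d\<close> only from
    \<open>U - L\<close>, which misses \<open>S\<close> by \<open>U_S\<close>. Without
    \<open>d\<close>, both children would have to be in \<open>S\<close>.\<close>
  have C_S: "d \<in> S" if d: "d \<in> C" for d
  proof (rule ccontr)
    assume "d \<notin> S"
    have "y \<in> S" if y: "y \<in> W" "h y = d" for y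
    proof -
      have "\<not> ((u, y) \<in> R \<or> (y, u) \<in> R)" if "u \<in> S" for u
        using U_S[of u] that y R_subset disjoint_parts(3) by blast
      then show ?thesis using dominated[of y] y \<open>d \<notin> S\<close> by auto
    qed
    then show False using two_children[OF d] sibling by blast
  qed
  have W_S: "y \<notin> S" if y: "y \<in> W" for y
  proof
    assume "y \<in> S"
    moreover have "h y \<in> S" "h y \<in> C" using C_S parent_W y by auto
    moreover have "y \<notin> C \<union> F" using y disjoint_parts by blast
    ultimately have "h y = y" using inj by (auto simp: inj_on_def centre_def)
    then show False using \<open>h y \<in> C\<close> \<open>y \<notin> C \<union> F\<close> by simp
  qed
  have F_S: "d \<in> S" if d: "d \<in> F" for d
  proof -
    obtain x where x: "x \<in> U - L" "h x = d" using other_child[OF d] by blast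
    then have "x \<notin> S" using U_S by blast
    moreover have "\<not> ((u, x) \<in> R \<or> (x, u) \<in> R)" if "u \<in> S" for u
      using W_S[of u] that x R_subset disjoint_parts(3) by blast
    ultimately show ?thesis using dominated[of x] x by auto
  qed
  have "C \<union> F \<subseteq> S" using C_S F_S by blast
  from card_subset_eq[OF fin this] card show ?thesis by simp
qed

lemma domination_number_G: "domination_number G = card (C \<union> F)"
  unfolding domination_number_def
  using dominating_set_centres card_dominating_set by (intro Least_equality) auto

lemma unique_minimum_dominating_set: "\<exists>!S. minimum_dominating_set G S"
  using dominating_set_centres dominating_set_unique
  by (auto simp: minimum_dominating_set_def domination_number_G)

end

section \<open>Realising edge counts on natural numbers\<close>

lemma B_graphs_with_size:
  fixes c f p q t :: nat
  assumes "c \<ge> 1" "f \<ge> 1" and t: "t \<le> (f + p) * (2 * c + q)"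
  shows "\<exists>G \<in> B_graphs (3 * (c + f) + p + q) (c + f). graph_size G = 2 * (c + f) + p + q + t"
proof -
  define b where "b = c + f"
  define e where "e = b + 2 * f + p"
  define n where "n = e + 2 * c + q"
  \<comment> \<open>Children are assigned to centres cyclically: the first \<open>f\<close> vertices
    from \<open>b\<close> on are the leaves, the next \<open>f\<close> the other children of
    \<open>F\<close>, and the first \<open>2 * c\<close> from \<open>e\<close> on give two children
    to each vertex of \<open>C\<close>. The \<open>p\<close> and \<open>q\<close> extra vertices
    follow in their blocks.\<close>
  define h where "h x = (if x < e then c + (x - b) mod f else (x - e) mod c)" for x
  have "card ({b + f..<e} \<times> {e..<n}) = (f + p) * (2 * c + q)"
    by (simp add: e_def n_def)
  then obtain R where R: "R \<subseteq> {b + f..<e} \<times> {e..<n}" "card R = t"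
    using t obtain_subset_with_card_n by metis
  interpret parent_graph "{0..<c}" "{c..<b}" "{b..<b + f}" "{b..<e}" "{e..<n}" h R
  proof
    show "h x \<in> {c..<b}" if "x \<in> {b..<e}" for x
      using that assms(2) by (simp add: h_def b_def)
    show "h y \<in> {0..<c}" if "y \<in> {e..<n}" for y
      using that assms(1) by (simp add: h_def)
    show "R \<subseteq> ({b..<e} - {b..<b + f}) \<times> {e..<n}"
      using R by auto
    show "\<exists>l\<in>{b..<b + f}. h l = d" if "d \<in> {c..<b}" for d
    proof
      show "b + (d - c) \<in> {b..<b + f}" using that by (auto simp: b_def)
      then show "h (b + (d - c)) = d" using that by (auto simp: h_def b_def e_def)
    qed
    show "\<exists>x\<in>{b..<e} - {b..<b + f}. h x = d" if "d \<in> {c..<b}" for d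
    proof
      show "b + f + (d - c) \<in> {b..<e} - {b..<b + f}" using that by (auto simp: b_def e_def)
      have "(f + (d - c)) mod f = d - c" using that by (simp only: mod_add_self1) (auto simp: b_def)
      moreover have "b + f + (d - c) < e" using that by (auto simp: b_def e_def)
      ultimately have "h (b + f + (d - c)) = c + (d - c)" by (simp add: h_def add.assoc)
      then show "h (b + f + (d - c)) = d" using that by simp
    qed
    show "\<exists>y\<in>{e..<n}. \<exists>z\<in>{e..<n}. y \<noteq> z \<and> h y = d \<and> h z = d" if "d \<in> {0..<c}" for d
      using that by (intro bexI[of _ "e + d"] bexI[of _ "e + c + d"]) (auto simp: h_def n_def)
  qed (auto simp: b_def e_def)
  have "{0..<c} \<union> {c..<b} = {0..<b}" by (auto simp: b_def)
  then have "G \<in> B_graphs (3 * (c + f) + p + q) (c + f)"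
    using finite_simple_graph_G bipartite_G no_isolated_vertices_G graph_order_G
      domination_number_G unique_minimum_dominating_set
    by (simp add: B_graphs_def b_def e_def n_def)
  moreover have "graph_size G = 2 * (c + f) + p + q + t"
    unfolding graph_size_G by (simp add: R b_def e_def n_def)
  ultimately show ?thesis by blast
qed

section \<open>Arithmetic of the edge count\<close>

lemma ceiling_half: "\<lceil>real_of_int i / 2\<rceil> = (i + 1) div 2"
  by (rule ceiling_unique) linarith+

lemma sum_ceiling_half:
  fixes a :: int and t :: nat
  shows "(\<Sum>i = 1..int t. a + \<lceil>real_of_int i / 2\<rceil>)
    = int t * a + int ((t + 1) div 2) * (int (t div 2) + 1)"
proof (induction t)
  case (Suc t)
  have "{1..int (Suc t)} = insert (int (Suc t)) {1..int t}" by auto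
  then have "(\<Sum>i = 1..int (Suc t). a + \<lceil>real_of_int i / 2\<rceil>)
      = a + (int (Suc t) + 1) div 2 + (\<Sum>i = 1..int t. a + \<lceil>real_of_int i / 2\<rceil>)"
    using ceiling_half[of "int (Suc t)"] by (simp add: ceiling_half)
  then show ?case unfolding Suc.IH
    by (cases "even t") (auto elim!: evenE oddE simp: algebra_simps)
qed simp

lemma m_edges_eq:
  fixes n \<gamma> c f t :: nat
  assumes c_def: "c = (\<gamma> + 1) div 2" and f_def: "f = \<gamma> div 2"
    and t: "int t = max 0 (int n - 3 * int \<gamma> - 2 * int c - int f + 1)"
  shows "m_edges n \<gamma> = 2 * int \<gamma> + 2 * int c * int f
    + min (int n - 3 * int \<gamma>) (2 * int c - int f + 1) * (2 * int c + 1)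
    + int t * (2 * int c + 1) + int ((t + 1) div 2) * (int (t div 2) + 1)"
proof -
  have c: "\<lceil>real \<gamma> / 2\<rceil> = int c"
    using ceiling_half[of "int \<gamma>"] by (simp add: c_def zdiv_int)
  have f: "\<lfloor>real \<gamma> / 2\<rfloor> = int f"
    by (simp add: f_def floor_divide_of_nat_eq[of \<gamma> 2, simplified])
  show ?thesis
    unfolding m_edges_def Phi_def c f t[symmetric] sum_ceiling_half by simp
qed

theorem theorem2p3:
  fixes n \<gamma> :: nat
  assumes "\<gamma> \<ge> 2" and "n \<ge> 3 * \<gamma>"
  shows "\<exists>G \<in> B_graphs n \<gamma>. int (graph_size G) = m_edges n \<gamma>"
proof -
  define c f where "c = (\<gamma> + 1) div 2" and "f = \<gamma> div 2"
  define k where "k = n - 3 * \<gamma>"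
  define t where "t = nat (int k - 2 * int c - int f + 1)"
  have \<gamma>: "\<gamma> = c + f" and cf: "c \<ge> 1" "f \<ge> 1" "f \<le> c"
    using assms(1) by (auto simp: c_def f_def)
  have n: "int n - 3 * int \<gamma> = int k" "n = 3 * (c + f) + k"
    using assms(2) \<gamma> by (auto simp: k_def)
  have t: "int t = max 0 (int n - 3 * int \<gamma> - 2 * int c - int f + 1)"
    unfolding n(1) t_def by simp
  have m: "m_edges n \<gamma> = 2 * int \<gamma> + 2 * int c * int f
    + min (int k) (2 * int c - int f + 1) * (2 * int c + 1)
    + int t * (2 * int c + 1) + int ((t + 1) div 2) * (int (t div 2) + 1)"
    using m_edges_eq[OF c_def f_def t] unfolding n(1) .
  show ?thesis
  proof (cases "k \<le> 2 * c - f + 1")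
    case True
    then have "t = 0" "min (int k) (2 * int c - int f + 1) = int k"
      using cf by (auto simp: t_def)
    then have "m_edges n \<gamma> = int (2 * (c + f) + k + (f + k) * (2 * c))"
      unfolding m by (simp add: \<gamma> algebra_simps)
    moreover obtain G where "G \<in> B_graphs n \<gamma>" "graph_size G = 2 * (c + f) + k + (f + k) * (2 * c)"
      \<comment> \<open>All \<open>k\<close> extra vertices become children of \<open>F\<close>, and
        \<open>R\<close> is complete.\<close>
      using B_graphs_with_size[of c f "(f + k) * (2 * c)" k 0] cf n(2) \<gamma> by auto
    ultimately show ?thesis by (metis (no_types))
  next
    case False
    define s where "s = k - (2 * c - f + 1)"
    have s: "int k = 2 * int c - int f + 1 + int s"
      using False cf by (simp add: s_def of_nat_diff)
    \<comment> \<open>After \<open>2 * c - f + 1\<close> extra vertices the sides of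
      \<open>R\<close> have sizes \<open>2 * c + 1\<close> and \<open>2 * c\<close>; the other
      \<open>s\<close> are split evenly to keep the product large.\<close>
    define p q where "p = 2 * c - f + 1 + s div 2" and "q = (s + 1) div 2"
    have pq: "p + q = k" using s cf by (simp add: p_def q_def)
    \<comment> \<open>Here \<open>t\<close> is the maximum of \<open>0\<close> and
      \<open>s - (2 * f - 2)\<close>, and \<open>1 \<le> f \<le> c\<close>.\<close>
    have ts: "t \<le> s" "s \<le> t + 2 * c"
      using s cf by (auto simp: t_def)
    \<comment> \<open>\<open>r\<close> is the number of edges that \<open>R\<close> has to supply.
      Replacing \<open>t\<close> by \<open>s\<close> in it yields the capacity
      \<open>(f + p) * (2 * c + q)\<close>, so \<open>t \<le> s\<close> gives the upper
      bound.\<close>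
    define r where "r = 2 * int c * (2 * int c + 1) + 2 * int c * int t - (int s - int t)
      + int ((t + 1) div 2) * (int (t div 2) + 1)"
    have mr: "m_edges n \<gamma> = 2 * int \<gamma> + int k + r"
      using s by (simp add: m r_def algebra_simps)
    have r0: "r \<ge> 0"
    proof -
      have "2 * int c * 1 \<le> 2 * int c * (2 * int c + 1)" by (intro mult_left_mono) auto
      moreover have "0 \<le> 2 * int c * int t" "0 \<le> int ((t + 1) div 2) * (int (t div 2) + 1)" by simp_all
      ultimately show ?thesis using ts unfolding r_def by linarith
    qed
    have "int ((t + 1) div 2) * (int (t div 2) + 1) \<le> int ((s + 1) div 2) * (int (s div 2) + 1)"
      using ts by (intro mult_mono) (auto intro: div_le_mono)
    moreover have "2 * int c * int t \<le> 2 * int c * int s"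
      using ts by (intro mult_left_mono) auto
    moreover have "int ((f + p) * (2 * c + q))
        = 2 * int c * (2 * int c + 1) + 2 * int c * int s + int ((s + 1) div 2) * (int (s div 2) + 1)"
    proof -
      have "int (f + p) = 2 * int c + 1 + int (s div 2)" using cf by (simp add: p_def)
      moreover have "int s = int (s div 2) + int ((s + 1) div 2)" by linarith
      ultimately show ?thesis by (simp only: of_nat_mult of_nat_add q_def) (simp add: algebra_simps)
    qed
    ultimately have "r \<le> int ((f + p) * (2 * c + q))"
      using ts unfolding r_def by linarith
    then have "nat r \<le> (f + p) * (2 * c + q)" by linarith
    from B_graphs_with_size[OF cf(1,2) this]
    obtain G where "G \<in> B_graphs n \<gamma>" "graph_size G = 2 * \<gamma> + k + nat r"
      using pq n(2) \<gamma> by (auto simp: add.assoc)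
    moreover from this(2) have "int (graph_size G) = m_edges n \<gamma>"
      using mr r0 by simp
    ultimately show ?thesis by blast
  qed
qed

end
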